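(* Let $1\leq p<\infty$, let $X,Z$ be real Banach spaces and let $S:X\to Z$ be a weakly $p$-precompact operator. Then for each Banach space $Y$ and every uniformly $p$-convergent set $N\subset C_p(Z,Y)$, the set $N\circ S:=\{T\circ S: T\in N\}$ is equicompact.
   Context: $L(X,Y)$ and $K(X,Y)$ are the spaces of bounded linear and of compact operators $X\to Y$; $B_X$ is the closed unit ball of $X$. A sequence $(x_n)_n$ in a Banach space $E$ is weakly $p$-summable if $(x^*(x_n))_n\in\ell_p$ for every $x^*\in E^*$; $\ell_p^w(E)$ denotes the set of such sequences. A sequence $(x_n)_n$ in $E$ is weakly $p$-Cauchy if $(x_{m_k}-x_{n_k})_k\in\ell_p^w(E)$ for all increasing sequences $(m_k)_k,(n_k)_k$ of positive integers. A subset of $E$ is weakly $p$-precompact if every sequence from it has a weakly $p$-Cauchy subsequence; an operator $S\in L(X,Z)$ is weakly $p$-precompact if $S(B_X)$ is weakly $p$-precompact. $C_p(Z,Y)$ is the space of $p$-convergent operators, i.e. $T\in L(Z,Y)$ with $\|T(z_n)\|\to0$ for all $(z_n)_n\in\ell_p^w(Z)$. A set $N\subset L(Z,Y)$ is uniformly $p$-convergent if $\lim_n\sup_{T\in N}\|T(z_n)\|=0$ for every $(z_n)_n\in\ell_p^w(Z)$. A set $M\subset K(X,Y)$ is equicompact if there is a norm-null sequence $(x_n^* )_n$ in $X^*$ with $\|T(x)\|\leq\sup_n|x_n^*(x)|$ for all $x\in X$ and $T\in M$; equivalently, every bounded sequence $(x_n)_n$ in $X$ has a subsequence $(x_{k_n})_n$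 such that $(Tx_{k_n})_n$ converges uniformly for $T\in M$. *)

theory Defs
  imports "HOL-Analysis.Analysis"
begin

definition compact_ops :: "('a::real_normed_vector \<Rightarrow>\<^sub>L 'b::real_normed_vector) set" where
  "compact_ops = {T. compact (closure (blinfun_apply T ` cball 0 1))}"

definition weakly_p_summable :: "real \<Rightarrow> (nat \<Rightarrow> 'a::real_normed_vector) \<Rightarrow> bool" where
  "weakly_p_summable p x \<longleftrightarrow>
     (\<forall>\<phi> :: 'a \<Rightarrow>\<^sub>L real. summable (\<lambda>n. \<bar>blinfun_apply \<phi> (x n)\<bar> powr p))"

(* "Increasing" index sequences are strictly increasing, i.e. they select subsequences;
   with constant index sequences allowed, only constant sequences would qualify. *)
definition weakly_p_Cauchy :: "real \<Rightarrow> (nat \<Rightarrow> 'a::real_normed_vector) \<Rightarrow> bool" where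
  "weakly_p_Cauchy p x \<longleftrightarrow>
     (\<forall>m n :: nat \<Rightarrow> nat. strict_mono m \<longrightarrow> strict_mono n \<longrightarrow>
        weakly_p_summable p (\<lambda>k. x (m k) - x (n k)))"

definition weakly_p_precompact :: "real \<Rightarrow> 'a::real_normed_vector set \<Rightarrow> bool" where
  "weakly_p_precompact p A \<longleftrightarrow>
     (\<forall>x :: nat \<Rightarrow> 'a. (\<forall>n. x n \<in> A) \<longrightarrow>
        (\<exists>r :: nat \<Rightarrow> nat. strict_mono r \<and> weakly_p_Cauchy p (x \<circ> r)))"

definition weakly_p_precompact_op ::
    "real \<Rightarrow> ('a::real_normed_vector \<Rightarrow>\<^sub>L 'b::real_normed_vector) \<Rightarrow> bool" where
  "weakly_p_precompact_op p S \<longleftrightarrow> weakly_p_precompact p (blinfun_apply S ` cball 0 1)"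

definition p_convergent_ops ::
    "real \<Rightarrow> ('a::real_normed_vector \<Rightarrow>\<^sub>L 'b::real_normed_vector) set" where
  "p_convergent_ops p =
     {T. \<forall>z. weakly_p_summable p z \<longrightarrow> (\<lambda>n. norm (blinfun_apply T (z n))) \<longlonglongrightarrow> 0}"

(* The supremum is taken in ennreal, so that it is infinite when N is unbounded at z n
   and 0 when N is empty. *)
definition uniformly_p_convergent ::
    "real \<Rightarrow> ('a::real_normed_vector \<Rightarrow>\<^sub>L 'b::real_normed_vector) set \<Rightarrow> bool" where
  "uniformly_p_convergent p N \<longleftrightarrow>
     (\<forall>z. weakly_p_summable p z \<longrightarrow>
        (\<lambda>n. SUP T\<in>N. ennreal (norm (blinfun_apply T (z n)))) \<longlonglongrightarrow> 0)"

(* The real supremum over n is over a bounded set, since \<phi> is norm-null. *)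
definition equicompact ::
    "('a::real_normed_vector \<Rightarrow>\<^sub>L 'b::real_normed_vector) set \<Rightarrow> bool" where
  "equicompact M \<longleftrightarrow>
     M \<subseteq> compact_ops \<and>
     (\<exists>\<phi> :: nat \<Rightarrow> ('a \<Rightarrow>\<^sub>L real).
        (\<lambda>n. norm (\<phi> n)) \<longlonglongrightarrow> 0 \<and>
        (\<forall>T\<in>M. \<forall>x. norm (blinfun_apply T x) \<le> (SUP n. \<bar>blinfun_apply (\<phi> n) x\<bar>)))"

end

theory Submission
  imports Defs
begin

text \<open>
  The seminorm \<open>q x = sup {\<parallel>T (S x)\<parallel> | T \<in> N}\<close> is finite, and the unit ball of \<open>X\<close> is totally
  bounded for it: a \<open>q\<close>-separated sequence in the ball would have a subsequence whose image under
  \<open>S\<close> is weakly \<open>p\<close>-Cauchy, and uniform \<open>p\<close>-convergence makes \<open>q\<close> of its consecutive differences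
  tend to 0. As in the Arzela-Ascoli theorem, the polar set of functionals dominated by \<open>q\<close> is then
  totally bounded in the dual, so by Grothendieck it lies in the closed convex hull of a norm-null
  sequence; by Hahn-Banach it determines \<open>q\<close>.
\<close>

section \<open>The Hahn-Banach theorem for sublinear functionals\<close>

text \<open>Only one half of positive homogeneity is demanded, the half that is convenient to check
  for infima; applying it to \<open>inverse c\<close> as well gives equality.\<close>

definition sublinear :: "('a::real_vector \<Rightarrow> real) \<Rightarrow> bool" where
  "sublinear p \<longleftrightarrow> (\<forall>x y. p (x + y) \<le> p x + p y) \<and> (\<forall>c>0. \<forall>x. p (c *\<^sub>R x) \<le> c * p x)"

lemma sublinear_add: "sublinear p \<Longrightarrow> p (x + y) \<le> p x + p y"
  by (simp add: sublinear_def)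

lemma sublinear_zero:
  assumes "sublinear p"
  shows "p 0 = 0"
proof -
  have "p ((1/2) *\<^sub>R 0) \<le> 1/2 * p 0"
    using assms unfolding sublinear_def by (metis half_gt_zero zero_less_one)
  moreover have "p (0 + 0) \<le> p 0 + p 0"
    by (rule sublinear_add[OF assms])
  ultimately show ?thesis by simp
qed

lemma sublinear_scaleR:
  assumes "sublinear p" "c \<ge> 0"
  shows "p (c *\<^sub>R x) = c * p x"
proof (cases "c = 0")
  case True
  then show ?thesis by (simp add: sublinear_zero assms)
next
  case False
  then have c: "c > 0" using assms by simp
  have le: "p (c *\<^sub>R x) \<le> c * p x"
    using assms c by (simp add: sublinear_def)
  have "p (inverse c *\<^sub>R (c *\<^sub>R x)) \<le> inverse c * p (c *\<^sub>R x)"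
    using assms(1) c unfolding sublinear_def by (meson positive_imp_inverse_positive)
  then have "c * p x \<le> p (c *\<^sub>R x)"
    using c by (simp add: field_simps)
  with le show ?thesis by simp
qed

lemma sublinear_ge_minus:
  assumes "sublinear p"
  shows "- p (- x) \<le> p x"
  using sublinear_add[OF assms, of x "- x"] sublinear_zero[OF assms] by simp

text \<open>This is the descent step for Zorn's lemma: a functional that cannot be lowered in this
  way is odd, hence linear.\<close>

lemma sublinear_tilt:
  fixes p :: "'a::real_vector \<Rightarrow> real"
  assumes p: "sublinear p"
  obtains p' where "sublinear p'" "p' \<le> p" "p' (- y) \<le> - p y"
proof -
  \<comment> \<open>This is the largest sublinear minorant with the required bound at
    \<open>- y\<close>: any such minorant \<open>h\<close> satisfies
    \<open>h x \<le> h (x + t *\<^sub>R y) + t * h (- y)\<close>.\<close>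
  define p' where "p' x = (INF t\<in>{0..}. p (x + t *\<^sub>R y) - t * p y)" for x
  have bdd: "bdd_below ((\<lambda>t. p (x + t *\<^sub>R y) - t * p y) ` {0..})" for x
  proof (rule bdd_belowI2[where m = "- p (- x)"])
    fix t :: real assume "t \<in> {0..}"
    then have "p (t *\<^sub>R y) = t * p y" by (simp add: sublinear_scaleR p)
    then show "- p (- x) \<le> p (x + t *\<^sub>R y) - t * p y"
      using sublinear_add[OF p, of "x + t *\<^sub>R y" "- x"] by simp
  qed
  have lower: "p' x \<le> p (x + t *\<^sub>R y) - t * p y" if "t \<ge> 0" for x t
    unfolding p'_def by (rule cINF_lower[OF bdd]) (use that in auto)
  have greatest: "m \<le> p' x" if "\<And>t. t \<ge> 0 \<Longrightarrow> m \<le> p (x + t *\<^sub>R y) - t * p y" for m x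
    unfolding p'_def by (rule cINF_greatest) (use that in auto)
  show thesis
  proof
    show "sublinear p'"
      unfolding sublinear_def
    proof (intro conjI allI impI)
      fix u v
      \<comment> \<open>Parameters \<open>s\<close> for \<open>u\<close> and \<open>t\<close> for
        \<open>v\<close> combine to \<open>s + t\<close> for \<open>u + v\<close>; the infima over
        \<open>t\<close> and over \<open>s\<close> are then taken one after the other.\<close>
      have *: "p' (u + v) \<le> (p (u + s *\<^sub>R y) - s * p y) + (p (v + t *\<^sub>R y) - t * p y)"
        if "s \<ge> 0" "t \<ge> 0" for s t
        using lower[of "s + t" "u + v"] that
          sublinear_add[OF p, of "u + s *\<^sub>R y" "v + t *\<^sub>R y"]
        by (simp add: algebra_simps)
      have "p' (u + v) - (p (u + s *\<^sub>R y) - s * p y) \<le> p' v" if "s \<ge> 0" for s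
        by (rule greatest) (use *[OF that] in \<open>smt (verit)\<close>)
      then have "p' (u + v) - p' v \<le> p' u"
        by (intro greatest) (smt (verit))
      then show "p' (u + v) \<le> p' u + p' v" by simp
    next
      fix c :: real and x assume c: "c > 0"
      have "p' (c *\<^sub>R x) / c \<le> p' x"
      proof (rule greatest)
        fix t :: real assume "t \<ge> 0"
        then have "p' (c *\<^sub>R x) \<le> p (c *\<^sub>R (x + t *\<^sub>R y)) - (c * t) * p y"
          using lower[of "c * t" "c *\<^sub>R x"] c by (simp add: scaleR_add_right)
        also have "p (c *\<^sub>R (x + t *\<^sub>R y)) = c * p (x + t *\<^sub>R y)"
          using c by (simp add: sublinear_scaleR p)
        finally show "p' (c *\<^sub>R x) / c \<le> p (x + t *\<^sub>R y) - t * p y"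
          using c by (simp add: field_simps)
      qed
      then show "p' (c *\<^sub>R x) \<le> c * p' x"
        using c by (simp add: field_simps)
    qed
    show "p' \<le> p"
      using lower[of 0] by (simp add: le_fun_def)
    show "p' (- y) \<le> - p y"
      using lower[of 1 "- y"] by (simp add: sublinear_zero p)
  qed
qed

text \<open>Subadditivity survives the infimum because of two members of a chain the smaller one
  lies below both. The common bound \<open>p\<close> keeps the infima finite, through
  \<open>- p (- x)\<close>.\<close>

lemma sublinear_INF_chain:
  fixes p :: "'a::real_vector \<Rightarrow> real"
  assumes "C \<noteq> {}" and sub: "\<And>f. f \<in> C \<Longrightarrow> sublinear f" and le: "\<And>f. f \<in> C \<Longrightarrow> f \<le> p"
    and chain: "\<And>f g. f \<in> C \<Longrightarrow> g \<in> C \<Longrightarrow> f \<le> g \<or> g \<le> f"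
  shows "sublinear (\<lambda>x. INF f\<in>C. f x)" and "f \<in> C \<Longrightarrow> (INF f\<in>C. f x) \<le> f x"
proof -
  have bdd: "bdd_below ((\<lambda>f. f x) ` C)" for x
  proof (rule bdd_belowI2[where m = "- p (- x)"])
    fix f assume f: "f \<in> C"
    show "- p (- x) \<le> f x"
      using sublinear_ge_minus[OF sub[OF f], of x] le_funD[OF le[OF f], of "- x"] by linarith
  qed
  have lower: "(INF f\<in>C. f x) \<le> f x" if "f \<in> C" for f x
    by (rule cINF_lower[OF bdd that])
  then show "f \<in> C \<Longrightarrow> (INF f\<in>C. f x) \<le> f x" .
  show "sublinear (\<lambda>x. INF f\<in>C. f x)"
    unfolding sublinear_def
  proof (intro conjI allI impI)
    fix x y
    have *: "(INF f\<in>C. f (x + y)) \<le> f x + g y" if fg: "f \<in> C" "g \<in> C" for f g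
    proof -
      obtain h where h: "h \<in> C" "h \<le> f" "h \<le> g"
        using chain[OF fg] fg by auto
      have "(INF f\<in>C. f (x + y)) \<le> h (x + y)" by (rule lower[OF h(1)])
      also have "\<dots> \<le> h x + h y" by (rule sublinear_add[OF sub[OF h(1)]])
      also have "\<dots> \<le> f x + g y" by (rule add_mono[OF le_funD[OF h(2)] le_funD[OF h(3)]])
      finally show ?thesis .
    qed
    have "(INF f\<in>C. f (x + y)) - f x \<le> (INF g\<in>C. g y)" if "f \<in> C" for f
      by (rule cINF_greatest[OF assms(1)]) (use *[OF that] in \<open>smt (verit)\<close>)
    then have "(INF f\<in>C. f (x + y)) - (INF g\<in>C. g y) \<le> (INF f\<in>C. f x)"
      by (intro cINF_greatest[OF assms(1)]) (smt (verit))
    then show "(INF f\<in>C. f (x + y)) \<le> (INF f\<in>C. f x) + (INF f\<in>C. f y)" by simp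
  next
    fix c :: real and x assume c: "c > 0"
    have "(INF f\<in>C. f (c *\<^sub>R x)) / c \<le> (INF f\<in>C. f x)"
    proof (rule cINF_greatest[OF assms(1)])
      fix f assume f: "f \<in> C"
      have "(INF f\<in>C. f (c *\<^sub>R x)) \<le> f (c *\<^sub>R x)" by (rule lower[OF f])
      also have "\<dots> = c * f x" using c by (simp add: sublinear_scaleR[OF sub[OF f]])
      finally show "(INF f\<in>C. f (c *\<^sub>R x)) / c \<le> f x" using c by (simp add: field_simps)
    qed
    then show "(INF f\<in>C. f (c *\<^sub>R x)) \<le> c * (INF f\<in>C. f x)"
      using c by (simp add: field_simps)
  qed
qed

lemma sublinear_dominates_linear:
  fixes p :: "'a::real_vector \<Rightarrow> real"
  assumes p: "sublinear p"
  obtains f where "linear f" "f \<le> p"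
proof -
  define A where "A = {f. sublinear f \<and> f \<le> p}"
  \<comment> \<open>Zorn's lemma is applied to the reversed pointwise order. A chain is bounded by
    its pointwise infimum, the empty chain by \<open>p\<close> itself.\<close>
  have "\<exists>m\<in>A. \<forall>a\<in>A. a \<le> m \<longrightarrow> a = m"
  proof (rule predicate_Zorn)
    show "partial_order_on A (relation_of (\<lambda>a b. b \<le> a) A)"
      by (rule partial_order_on_relation_ofI) auto
    fix C assume "C \<in> Chains (relation_of (\<lambda>a b. b \<le> a) A)"
    then have C: "C \<subseteq> A" "\<And>f g. f \<in> C \<Longrightarrow> g \<in> C \<Longrightarrow> f \<le> g \<or> g \<le> f"
      by (auto simp: Chains_def relation_of_def)
    show "\<exists>u\<in>A. \<forall>a\<in>C. u \<le> a"
    proof (cases "C = {}")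
      case True
      then show ?thesis using p by (auto simp: A_def)
    next
      case False
      define u where "u x = (INF f\<in>C. f x)" for x
      have "sublinear u"
        unfolding u_def by (rule sublinear_INF_chain(1)[OF False, where p = p]) (use C in \<open>auto simp: A_def\<close>)
      moreover have u: "u \<le> f" if "f \<in> C" for f
        unfolding u_def
        by (rule le_funI, rule sublinear_INF_chain(2)[OF False, where p = p])
          (use C that in \<open>auto simp: A_def\<close>)
      moreover have "u \<le> p"
      proof -
        obtain f where "f \<in> C" using False by blast
        then show ?thesis using u[of f] C(1) order_trans[of u f p] by (auto simp: A_def)
      qed
      ultimately show ?thesis by (auto simp: A_def)
    qed
  qed
  then obtain m where m: "sublinear m" "m \<le> p"
    and min: "\<And>a. sublinear a \<Longrightarrow> a \<le> p \<Longrightarrow> a \<le> m \<Longrightarrow> a = m"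
    by (auto simp: A_def)
  \<comment> \<open>Tilting cannot lower the minimal \<open>m\<close>, so the tilted functional
    equals \<open>m\<close>, which therefore inherits the bound at \<open>- y\<close>.\<close>
  have odd: "m (- y) = - m y" for y
  proof -
    obtain m' where m': "sublinear m'" "m' \<le> m" "m' (- y) \<le> - m y"
      using sublinear_tilt[OF m(1)] .
    then have "m' = m" using min m(2) order_trans by blast
    then show ?thesis using m'(3) sublinear_ge_minus[OF m(1), of y] by simp
  qed
  have "linear m"
  proof (rule linearI)
    fix x y
    show "m (x + y) = m x + m y"
      using sublinear_add[OF m(1), of x y] sublinear_add[OF m(1), of "- x" "- y"]
        odd[of "x + y"] odd[of x] odd[of y] by simp
  next
    fix c :: real and x
    show "m (c *\<^sub>R x) = c *\<^sub>R m x"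
    proof (cases "c \<ge> 0")
      case True
      then show ?thesis by (simp add: sublinear_scaleR m)
    next
      case False
      then have "m ((- c) *\<^sub>R x) = (- c) * m x" by (intro sublinear_scaleR m) simp
      then show ?thesis using odd[of "c *\<^sub>R x"] by simp
    qed
  qed
  then show thesis using that m(2) by blast
qed

text \<open>Tilting at \<open>x\<close> before passing to a linear minorant forces
  \<open>f (- x) \<le> - p x\<close>, that is \<open>f x \<ge> p x\<close>.\<close>

theorem Hahn_Banach_sublinear:
  fixes p :: "'a::real_vector \<Rightarrow> real"
  assumes p: "sublinear p"
  obtains f where "linear f" "f \<le> p" "f x = p x"
proof -
  obtain p' where p': "sublinear p'" "p' \<le> p" "p' (- x) \<le> - p x"
    using sublinear_tilt[OF p] .
  obtain f where f: "linear f" "f \<le> p'"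
    using sublinear_dominates_linear[OF p'(1)] .
  have "f (- x) \<le> p' (- x)" "f x \<le> p' x" "p' x \<le> p x"
    using f(2) p'(2) by (auto simp: le_fun_def)
  then have "f x = p x" using p'(3) linear_neg[OF f(1), of x] by simp
  then show thesis using that f p'(2) order_trans by blast
qed

section \<open>Totally bounded sets and null sequences\<close>

lemma norm_null_enumeration:
  fixes U :: "'a::real_normed_vector set"
  assumes fin: "\<And>e. e > 0 \<Longrightarrow> finite {u \<in> U. norm u \<ge> e}"
  obtains \<phi> :: "nat \<Rightarrow> 'a" where "\<phi> \<longlonglongrightarrow> 0" "U \<subseteq> range \<phi>"
proof -
  have "U \<subseteq> insert 0 (\<Union>n. {u \<in> U. norm u \<ge> 1 / real (Suc n)})"
  proof
    fix u assume "u \<in> U"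
    show "u \<in> insert 0 (\<Union>n. {u \<in> U. norm u \<ge> 1 / real (Suc n)})"
    proof (cases "u = 0")
      case False
      then obtain n where "1 / real (Suc n) < norm u"
        using nat_approx_posE[of "norm u"] by auto
      then show ?thesis using \<open>u \<in> U\<close> by (intro insertI2 UN_I[of n]) auto
    qed simp
  qed
  moreover have "countable \<dots>"
    by (intro countable_insert countable_UN countableI_type countable_finite fin) simp
  ultimately have U: "countable U" by (rule countable_subset)
  define \<phi> where "\<phi> n = (if n \<in> to_nat_on U ` U then from_nat_into U n else 0)" for n
  show thesis
  proof
    show "\<phi> \<longlonglongrightarrow> 0"
    proof (rule tendstoI)
      fix e :: real assume e: "e > 0"
      have "{n. \<not> dist (\<phi> n) 0 < e} \<subseteq> to_nat_on U ` {u \<in> U. norm u \<ge> e}"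
        using U e by (auto simp: \<phi>_def split: if_splits)
      then have "finite {n. \<not> dist (\<phi> n) 0 < e}"
        by (rule finite_subset) (intro finite_imageI fin e)
      then show "\<forall>\<^sub>F n in sequentially. dist (\<phi> n) 0 < e"
        by (simp add: cofinite_eq_sequentially[symmetric] eventually_cofinite)
    qed
    show "U \<subseteq> range \<phi>"
    proof
      fix u assume "u \<in> U"
      then have "\<phi> (to_nat_on U u) = u" using U by (simp add: \<phi>_def)
      then show "u \<in> range \<phi>" by (metis rangeI)
    qed
  qed
qed

text \<open>The weights add up to \<open>1 - (1/2) ^ n\<close>, and the missing mass sits at 0.
  Splitting off the first term leaves half of a shifted sum of the same kind.\<close>

lemma convex_dyadic_sum:
  fixes H :: "'a::real_vector set"
  assumes H: "convex H" "0 \<in> H" and "\<And>i. u i \<in> H"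
  shows "(\<Sum>i<n. (1/2) ^ Suc i *\<^sub>R u i) \<in> H"
  using assms(3)
proof (induction n arbitrary: u)
  case 0
  then show ?case using H by simp
next
  case (Suc n)
  have "(1/2) *\<^sub>R u 0 + (1/2) *\<^sub>R (\<Sum>i<n. (1/2) ^ Suc i *\<^sub>R u (Suc i)) \<in> H"
    by (rule convexD[OF H(1)]) (use Suc in auto)
  then show ?case
    by (simp add: sum.lessThan_Suc_shift scaleR_sum_right del: sum.lessThan_Suc)
qed

text \<open>Points of \<open>K\<close> are telescoping sums of differences of points in successive nets.\<close>

theorem totally_bounded_in_hull_of_null_sequence:
  fixes K :: "'a::real_normed_vector set"
  assumes "\<And>e. e > 0 \<Longrightarrow> \<exists>F. finite F \<and> K \<subseteq> (\<Union>x\<in>F. ball x e)"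
  obtains \<phi> :: "nat \<Rightarrow> 'a" where "\<phi> \<longlonglongrightarrow> 0" "K \<subseteq> closure (convex hull (insert 0 (range \<phi>)))"
proof -
  \<comment> \<open>The radii shrink like \<open>4 ^ (- n)\<close> so that they still tend to 0
    after the scaling by powers of 2 in \<open>U\<close>.\<close>
  define e :: "nat \<Rightarrow> real" where "e n = (1/4) ^ n" for n
  have e_pos: "e n > 0" for n by (simp add: e_def)
  have "\<exists>F. \<forall>n. finite (F n) \<and> K \<subseteq> (\<Union>x\<in>F n. ball x (e n))"
    using assms[OF e_pos] by metis
  then obtain F where F: "\<And>n. finite (F n)" "\<And>n. K \<subseteq> (\<Union>x\<in>F n. ball x (e n))"
    by blast
  define D where "D i = (case i of 0 \<Rightarrow> F 0
      | Suc n \<Rightarrow> {g - h | g h. g \<in> F (Suc n) \<and> h \<in> F n \<and> norm (g - h) \<le> 2 * e n})" for i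
  \<comment> \<open>The factor \<open>2 ^ Suc i\<close> cancels the weight of the i-th term in
    \<open>convex_dyadic_sum\<close>.\<close>
  define U where "U = (\<Union>i. (\<lambda>d. 2 ^ Suc i *\<^sub>R d) ` D i)"
  have finD: "finite (D i)" for i
  proof (cases i)
    case (Suc n)
    have "D i \<subseteq> (\<lambda>(g, h). g - h) ` (F (Suc n) \<times> F n)"
      by (auto simp: D_def Suc)
    then show ?thesis by (rule finite_subset) (simp add: F)
  qed (simp add: D_def F)
  \<comment> \<open>For \<open>i = Suc n\<close> the bound is
    \<open>2 ^ (n + 2) * 2 * (1/4) ^ n = 8 * (1/2) ^ n\<close>, which is
    \<open>16 * (1/2) ^ i\<close>.\<close>
  have small: "norm (2 ^ Suc i *\<^sub>R d) \<le> 16 * (1/2) ^ i" if "d \<in> D i" "i > 0" for i d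
  proof -
    obtain n where n: "i = Suc n" using \<open>i > 0\<close> by (cases i) auto
    have "norm d \<le> 2 * e n" using that by (auto simp: D_def n)
    then have "2 ^ Suc i * norm d \<le> 2 ^ Suc i * (2 * e n)" by (intro mult_left_mono) auto
    also have "\<dots> = 16 * (1/2) ^ i"
      by (simp add: n e_def power_divide) (simp add: power_mult_distrib[symmetric] field_simps)
    finally show ?thesis by simp
  qed
  have finU: "finite {u \<in> U. norm u \<ge> r}" if r: "r > 0" for r
  proof -
    have "(\<lambda>i. 16 * (1/2) ^ i :: real) \<longlonglongrightarrow> 16 * 0"
      by (intro tendsto_intros LIMSEQ_power_zero) simp
    then have "\<forall>\<^sub>F i in sequentially. 16 * (1/2) ^ i < r"
      using r by (intro order_tendstoD(2)) auto
    then obtain m where m: "\<And>i. i \<ge> m \<Longrightarrow> 16 * (1/2) ^ i < r"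
      by (auto simp: eventually_sequentially)
    have "{u \<in> U. norm u \<ge> r} \<subseteq> (\<Union>i\<in>{..m}. (\<lambda>d. 2 ^ Suc i *\<^sub>R d) ` D i)"
    proof
      fix u assume "u \<in> {u \<in> U. norm u \<ge> r}"
      then obtain i d where d: "d \<in> D i" "u = 2 ^ Suc i *\<^sub>R d" "norm u \<ge> r"
        unfolding U_def by blast
      have "i \<le> m"
      proof (rule ccontr)
        assume "\<not> i \<le> m"
        then have "norm u \<le> 16 * (1/2) ^ i" "16 * (1/2) ^ i < r"
          using small[OF d(1)] m[of i] by (auto simp only: d(2))
        then show False using d(3) by linarith
      qed
      then show "u \<in> (\<Union>i\<in>{..m}. (\<lambda>d. 2 ^ Suc i *\<^sub>R d) ` D i)"
        using d by blast
    qed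
    then show ?thesis by (rule finite_subset) (use finD in auto)
  qed
  obtain \<phi> where \<phi>: "\<phi> \<longlonglongrightarrow> 0" "U \<subseteq> range \<phi>"
    using norm_null_enumeration[OF finU] .
  let ?H = "convex hull (insert 0 (range \<phi>))"
  have "f \<in> closure ?H" if f: "f \<in> K" for f
  proof -
    have "\<exists>g. \<forall>n. g n \<in> F n \<and> dist (g n) f < e n"
      using F(2) f by (intro choice allI) (fastforce simp: subset_iff)
    then obtain g where g: "\<And>n. g n \<in> F n" "\<And>n. dist (g n) f < e n" by blast
    define d where "d i = (case i of 0 \<Rightarrow> g 0 | Suc n \<Rightarrow> g (Suc n) - g n)" for i
    have dD: "d i \<in> D i" for i
    proof (cases i)
      case (Suc n)
      have "norm (g (Suc n) - g n) \<le> dist (g (Suc n)) f + dist (g n) f"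
        using dist_triangle2 by (metis dist_norm)
      also have "\<dots> \<le> e (Suc n) + e n"
        using g(2) by (intro add_mono less_imp_le)
      also have "\<dots> \<le> 2 * e n" by (simp add: e_def)
      finally show ?thesis using g(1) by (auto simp: d_def D_def Suc)
    qed (simp add: d_def D_def g)
    define u where "u i = 2 ^ Suc i *\<^sub>R d i" for i
    have uH: "u i \<in> ?H" for i
      by (rule hull_inc) (use dD \<phi>(2) in \<open>auto simp: u_def U_def\<close>)
    \<comment> \<open>The weights cancel and the differences telescope, so every approximant
      \<open>g n\<close> lies in the hull.\<close>
    have sum: "(\<Sum>i<Suc n. (1/2) ^ Suc i *\<^sub>R u i) = g n" for n
    proof -
      have "(1/2) ^ Suc i *\<^sub>R u i = d i" for i
        by (simp add: u_def power_divide)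
      then have "(\<Sum>i<Suc n. (1/2) ^ Suc i *\<^sub>R u i) = (\<Sum>i<Suc n. d i)" by simp
      also have "\<dots> = g n"
        by (induction n) (simp_all add: d_def)
      finally show ?thesis .
    qed
    have "g n \<in> ?H" for n
      unfolding sum[symmetric]
      by (rule convex_dyadic_sum[OF convex_convex_hull _ uH]) (simp add: hull_inc)
    moreover have "g \<longlonglongrightarrow> f"
    proof -
      have "(\<lambda>n. dist (g n) f) \<longlonglongrightarrow> 0"
      proof (rule tendsto_sandwich[of "\<lambda>_. 0" _ _ e])
        show "e \<longlonglongrightarrow> 0" unfolding e_def by (rule LIMSEQ_power_zero) simp
        show "\<forall>\<^sub>F n in sequentially. dist (g n) f \<le> e n"
          using g(2) by (intro always_eventually allI less_imp_le)
      qed auto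
      then show ?thesis by (rule iffD2[OF tendsto_dist_iff])
    qed
    ultimately show ?thesis by (meson closure_sequential)
  qed
  then show thesis using that \<phi>(1) by blast
qed

section \<open>Seminorms for which the unit ball is totally bounded\<close>

text \<open>Rounding the values on \<open>I\<close> down to multiples of \<open>d\<close> leaves
  finitely many patterns; \<open>G\<close> takes one member of \<open>A\<close> for each pattern
  that occurs.\<close>

lemma finite_net_of_bounded_functions:
  fixes A :: "('a \<Rightarrow> real) set"
  assumes "finite I" and bnd: "\<And>f i. f \<in> A \<Longrightarrow> i \<in> I \<Longrightarrow> \<bar>f i\<bar> \<le> C i" and d: "d > 0"
  obtains G where "finite G" "G \<subseteq> A" "\<And>f. f \<in> A \<Longrightarrow> \<exists>g\<in>G. \<forall>i\<in>I. \<bar>f i - g i\<bar> < d"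
proof -
  define code where "code f = restrict (\<lambda>i. \<lfloor>f i / d\<rfloor>) I" for f
  have "code ` A \<subseteq> (\<Pi>\<^sub>E i\<in>I. {\<lfloor>- C i / d\<rfloor>..\<lfloor>C i / d\<rfloor>})"
  proof (rule image_subsetI)
    fix f assume f: "f \<in> A"
    have "\<lfloor>- C i / d\<rfloor> \<le> \<lfloor>f i / d\<rfloor> \<and> \<lfloor>f i / d\<rfloor> \<le> \<lfloor>C i / d\<rfloor>" if "i \<in> I" for i
      using bnd[OF f that] d by (intro conjI floor_mono divide_right_mono) auto
    then show "code f \<in> (\<Pi>\<^sub>E i\<in>I. {\<lfloor>- C i / d\<rfloor>..\<lfloor>C i / d\<rfloor>})"
      by (simp add: code_def)
  qed
  then have "finite (code ` A)"
    by (rule finite_subset) (intro finite_PiE assms(1) finite_atLeastAtMost_int)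
  then obtain G where G: "G \<subseteq> A" "finite G" "code ` A = code ` G"
    by (metis finite_subset_image order_refl)
  show thesis
  proof
    fix f assume "f \<in> A"
    then obtain g where g: "g \<in> G" "code f = code g" using G(3) by blast
    have "\<bar>f i - g i\<bar> < d" if "i \<in> I" for i
    proof -
      have "\<lfloor>f i / d\<rfloor> = \<lfloor>g i / d\<rfloor>"
        using fun_cong[OF g(2), of i] that by (simp add: code_def)
      then have "\<bar>f i / d - g i / d\<bar> < 1" by linarith
      then show ?thesis
        using d by (simp add: diff_divide_distrib[symmetric] abs_divide)
    qed
    then show "\<exists>g\<in>G. \<forall>i\<in>I. \<bar>f i - g i\<bar> < d" using g(1) by blast
  qed (use G in auto)
qed

text \<open>The functionals \<open>g\<close> with \<open>\<bar>g x\<bar> \<le> s\<close> form a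
  closed convex set containing 0 and every \<open>\<phi> n\<close>. Convergence of
  \<open>\<phi>\<close> makes the real supremum \<open>s\<close> meaningful.\<close>

lemma abs_blinfun_le_SUP:
  fixes \<phi> :: "nat \<Rightarrow> 'a::real_normed_vector \<Rightarrow>\<^sub>L real"
  assumes "\<phi> \<longlonglongrightarrow> 0" and f: "f \<in> closure (convex hull (insert 0 (range \<phi>)))"
  shows "\<bar>blinfun_apply f x\<bar> \<le> (SUP n. \<bar>blinfun_apply (\<phi> n) x\<bar>)"
proof -
  define s where "s = (SUP n. \<bar>blinfun_apply (\<phi> n) x\<bar>)"
  have "(\<lambda>n. \<bar>blinfun_apply (\<phi> n) x\<bar>) \<longlonglongrightarrow> \<bar>blinfun_apply 0 x\<bar>"
    by (intro tendsto_intros assms(1))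
  then have "bdd_above (range (\<lambda>n. \<bar>blinfun_apply (\<phi> n) x\<bar>))"
    by (intro bounded_imp_bdd_above convergent_imp_bounded)
  then have s: "\<bar>blinfun_apply (\<phi> n) x\<bar> \<le> s" for n
    unfolding s_def by (intro cSUP_upper) auto
  have "0 \<le> s" using s[of 0] by linarith
  define A where "A = {g :: 'a \<Rightarrow>\<^sub>L real. \<bar>blinfun_apply g x\<bar> \<le> s}"
  have "A = (\<lambda>g. blinfun_apply g x) -` cball 0 s"
    by (auto simp: A_def)
  moreover have "bounded_linear (\<lambda>g :: 'a \<Rightarrow>\<^sub>L real. blinfun_apply g x)"
    by (rule blinfun.bounded_linear_left)
  ultimately have "closed A" "convex A"
    by (auto intro!: closed_vimage linear_continuous_on convex_linear_vimage
        simp: bounded_linear.linear)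
  moreover have "insert 0 (range \<phi>) \<subseteq> A"
    using s \<open>0 \<le> s\<close> by (auto simp: A_def)
  ultimately have "closure (convex hull (insert 0 (range \<phi>))) \<subseteq> A"
    by (intro closure_minimal hull_minimal)
  then show ?thesis using f by (auto simp: A_def s_def)
qed

theorem seminorm_le_SUP_null_sequence:
  fixes q :: "'a::real_normed_vector \<Rightarrow> real"
  assumes add: "\<And>x y. q (x + y) \<le> q x + q y" and scale: "\<And>c x. q (c *\<^sub>R x) = \<bar>c\<bar> * q x"
    and net: "\<And>e. e > 0 \<Longrightarrow> \<exists>F. finite F \<and> (\<forall>x\<in>cball 0 1. \<exists>y\<in>F. q (x - y) < e)"
  obtains \<phi> :: "nat \<Rightarrow> 'a \<Rightarrow>\<^sub>L real"
    where "\<phi> \<longlonglongrightarrow> 0" "\<And>x. q x \<le> (SUP n. \<bar>blinfun_apply (\<phi> n) x\<bar>)"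
proof -
  have q_minus: "q (- x) = q x" for x using scale[of "-1" x] by simp
  have q_0: "q 0 = 0" using scale[of 0 0] by simp
  have q_ge_0: "q x \<ge> 0" for x using add[of x "- x"] q_minus[of x] q_0 by simp
  \<comment> \<open>A finite net of radius 1 bounds \<open>q\<close> on the unit ball. Later
    \<open>C\<close> makes the Hahn-Banach functional continuous.\<close>
  obtain C where C: "\<And>x. q x \<le> norm x * C"
  proof -
    obtain F where F: "finite F" "\<And>x. x \<in> cball 0 1 \<Longrightarrow> \<exists>y\<in>F. q (x - y) < 1"
      using net[of 1] by auto
    have ball: "q x \<le> 1 + (\<Sum>y\<in>F. q y)" if x: "x \<in> cball 0 1" for x
    proof -
      obtain y where "y \<in> F" "q (x - y) < 1" using F(2)[OF x] by blast
      moreover have "q y \<le> (\<Sum>y\<in>F. q y)"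
        by (rule member_le_sum) (use \<open>y \<in> F\<close> F q_ge_0 in auto)
      ultimately show ?thesis using add[of "x - y" y] by simp
    qed
    have "q x \<le> norm x * (1 + (\<Sum>y\<in>F. q y))" for x
    proof -
      have "q x = norm x * q (sgn x)"
        using scale[of "norm x" "sgn x"] by (cases "x = 0") (simp_all add: q_0 sgn_div_norm)
      also have "\<dots> \<le> norm x * (1 + (\<Sum>y\<in>F. q y))"
        by (intro mult_left_mono ball) (auto simp: norm_sgn)
      finally show ?thesis .
    qed
    then show thesis by (rule that)
  qed
  \<comment> \<open>This is the polar of the unit ball of \<open>q\<close>.\<close>
  define K :: "('a \<Rightarrow>\<^sub>L real) set" where "K = {f. \<forall>x. \<bar>blinfun_apply f x\<bar> \<le> q x}"
  have K_net: "\<exists>G. finite G \<and> K \<subseteq> (\<Union>g\<in>G. ball g e)" if e: "e > 0" for e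
  proof -
    \<comment> \<open>For \<open>y\<close> near \<open>x\<close>, the difference
      \<open>(f - g) x\<close> splits into \<open>f (x - y)\<close>, \<open>g (x - y)\<close> and
      \<open>f y - g y\<close>. Three times \<open>e / 6\<close> gives norm at most
      \<open>e / 2\<close>, hence an open ball of radius \<open>e\<close>.\<close>
    obtain F where F: "finite F" "\<And>x. x \<in> cball 0 1 \<Longrightarrow> \<exists>y\<in>F. q (x - y) < e / 6"
      using net[of "e / 6"] e by auto
    obtain G where G: "finite G" "G \<subseteq> blinfun_apply ` K"
      "\<And>f. f \<in> blinfun_apply ` K \<Longrightarrow> \<exists>g\<in>G. \<forall>y\<in>F. \<bar>f y - g y\<bar> < e / 6"
      proof (rule finite_net_of_bounded_functions[OF F(1), of "blinfun_apply ` K" q "e / 6"])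
      show "\<bar>f y\<bar> \<le> q y" if "f \<in> blinfun_apply ` K" for f y
        using that by (auto simp: K_def)
    qed (use e in auto)
    obtain G' where G': "G' \<subseteq> K" "finite G'" "G = blinfun_apply ` G'"
      using finite_subset_image[OF G(1,2)] by blast
    have "f \<in> (\<Union>g\<in>G'. ball g e)" if f: "f \<in> K" for f
    proof -
      obtain g where g: "g \<in> G'" "\<And>y. y \<in> F \<Longrightarrow> \<bar>blinfun_apply f y - blinfun_apply g y\<bar> < e / 6"
        using G(3)[of "blinfun_apply f"] f G'(3) by auto
      have "g \<in> K" using g G' by auto
      have unit: "\<bar>blinfun_apply (f - g) x\<bar> \<le> e / 2" if x: "x \<in> cball 0 1" for x
      proof -
        obtain y where y: "y \<in> F" "q (x - y) < e / 6" using F(2)[OF x] by blast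
        have "\<bar>blinfun_apply f (x - y)\<bar> \<le> q (x - y)" "\<bar>blinfun_apply g (x - y)\<bar> \<le> q (x - y)"
          using f \<open>g \<in> K\<close> by (auto simp: K_def)
        then show ?thesis
          using y(2) g(2)[OF y(1)] unfolding blinfun.diff_left blinfun.diff_right by linarith
      qed
      have "norm (blinfun_apply (f - g) x) \<le> e / 2 * norm x" for x
      proof (cases "x = 0")
        case False
        have "norm x * \<bar>blinfun_apply (f - g) (sgn x)\<bar> \<le> norm x * (e / 2)"
          by (intro mult_left_mono unit) (auto simp: norm_sgn)
        moreover have "norm x * \<bar>blinfun_apply (f - g) (sgn x)\<bar> = \<bar>blinfun_apply (f - g) x\<bar>"
          using False by (simp add: sgn_div_norm blinfun.scaleR_right abs_mult)
        ultimately show ?thesis by (simp add: mult.commute)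
      qed simp
      then have "norm (f - g) \<le> e / 2"
        using e by (intro norm_blinfun_bound) auto
      then have "f \<in> ball g e" using e by (simp add: dist_norm norm_minus_commute)
      then show ?thesis using g(1) by blast
    qed
    then show ?thesis using G'(2) by blast
  qed
  obtain \<phi> where \<phi>: "\<phi> \<longlonglongrightarrow> 0" "K \<subseteq> closure (convex hull (insert 0 (range \<phi>)))"
    using totally_bounded_in_hull_of_null_sequence[OF K_net] .
  have "q x \<le> (SUP n. \<bar>blinfun_apply (\<phi> n) x\<bar>)" for x
  proof -
    have sub: "sublinear q" by (simp add: sublinear_def add scale)
    obtain f where f: "linear f" "f \<le> q" "f x = q x"
      using Hahn_Banach_sublinear[OF sub, of x] by blast
    \<comment> \<open>Since \<open>q\<close> is even, the one-sided bound at \<open>y\<close> and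
      \<open>- y\<close> bounds the absolute value.\<close>
    have f_le: "\<bar>f y\<bar> \<le> q y" for y
      using le_funD[OF f(2), of y] le_funD[OF f(2), of "- y"] q_minus[of y] linear_neg[OF f(1), of y]
      by simp
    have "bounded_linear f"
      by (rule bounded_linear_intro[of _ C])
        (use order_trans[OF f_le C] in \<open>auto simp: linear_add[OF f(1)] linear_scale[OF f(1)]\<close>)
    then have app: "blinfun_apply (Blinfun f) = f" by (rule bounded_linear_Blinfun_apply)
    then have "Blinfun f \<in> K" using f_le by (simp add: K_def)
    then have "\<bar>blinfun_apply (Blinfun f) x\<bar> \<le> (SUP n. \<bar>blinfun_apply (\<phi> n) x\<bar>)"
      using \<phi> by (intro abs_blinfun_le_SUP) auto
    then show ?thesis using f(3) app by simp
  qed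
  then show thesis using that \<phi>(1) by blast
qed

section \<open>Uniform p-convergence and equicompactness\<close>

text \<open>The ratio \<open>(1/2) powr p\<close> is below 1. These test sequences extract pointwise
  boundedness from uniform p-convergence.\<close>

lemma weakly_p_summable_geometric:
  assumes "1 \<le> p"
  shows "weakly_p_summable p (\<lambda>n. (1/2) ^ n *\<^sub>R z)"
  unfolding weakly_p_summable_def
proof
  fix \<phi> :: "'a \<Rightarrow>\<^sub>L real"
  have "((1/2::real) ^ n) powr p = ((1/2) powr p) ^ n" for n
    by (induction n) (simp_all only: power_0 power_Suc powr_mult powr_one_eq_one)
  then have "\<bar>blinfun_apply \<phi> ((1/2) ^ n *\<^sub>R z)\<bar> powr p
      = ((1/2) powr p) ^ n * \<bar>blinfun_apply \<phi> z\<bar> powr p" for n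
    by (simp add: blinfun.scaleR_right abs_mult powr_mult)
  moreover have "(1/2::real) powr p < 1"
    using powr_less_mono2[of p "1/2" 1] assms by simp
  ultimately show "summable (\<lambda>n. \<bar>blinfun_apply \<phi> ((1/2) ^ n *\<^sub>R z)\<bar> powr p)"
    by (simp add: summable_geometric summable_mult2)
qed

lemma uniformly_p_convergent_eventually:
  assumes "uniformly_p_convergent p N" "weakly_p_summable p z" "e > 0"
  shows "\<forall>\<^sub>F n in sequentially. \<forall>T\<in>N. norm (blinfun_apply T (z n)) < e"
proof -
  have "\<forall>\<^sub>F n in sequentially. (SUP T\<in>N. ennreal (norm (blinfun_apply T (z n)))) < ennreal e"
    using assms unfolding uniformly_p_convergent_def by (intro order_tendstoD(2)) auto
  then show ?thesis
  proof eventually_elim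
    case (elim n)
    show ?case
    proof
      fix T assume "T \<in> N"
      then have "ennreal (norm (blinfun_apply T (z n))) < ennreal e"
        using elim by (meson SUP_upper le_less_trans)
      then show "norm (blinfun_apply T (z n)) < e" by (simp add: ennreal_less_iff)
    qed
  qed
qed

text \<open>Along \<open>(1/2) ^ n *\<^sub>R z\<close> the supremum over \<open>N\<close> is
  eventually below 1; scaling back bounds \<open>N\<close> at \<open>z\<close> by
  \<open>2 ^ n\<close>.\<close>

lemma uniformly_p_convergent_pointwise_bounded:
  assumes "1 \<le> p" "uniformly_p_convergent p N"
  shows "\<exists>C. \<forall>T\<in>N. norm (blinfun_apply T z) \<le> C"
proof -
  obtain n where "\<forall>T\<in>N. norm (blinfun_apply T ((1/2) ^ n *\<^sub>R z)) < 1"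
    using uniformly_p_convergent_eventually[OF assms(2) weakly_p_summable_geometric[OF assms(1)], of 1 z]
    by (auto simp: eventually_sequentially)
  then have "\<forall>T\<in>N. norm (blinfun_apply T z) \<le> 2 ^ n"
    by (auto simp: blinfun.scaleR_right power_divide field_simps intro: less_imp_le)
  then show ?thesis ..
qed

text \<open>Each term is chosen against the finite set of all earlier ones. With \<open>R\<close>
  read as being far apart, this extracts a separated sequence where finite nets fail.\<close>

lemma separated_sequence:
  assumes "\<And>F. finite F \<Longrightarrow> F \<subseteq> A \<Longrightarrow> \<exists>x\<in>A. \<forall>y\<in>F. R y x"
  obtains x :: "nat \<Rightarrow> 'a" where "\<And>n. x n \<in> A" "\<And>m n. m < n \<Longrightarrow> R (x m) (x n)"
proof -
  have "\<exists>x. \<forall>n::nat. x n \<in> A \<and> (\<forall>m<n. R (x m) (x n))"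
  proof (rule dependent_wellorder_choice)
    fix n :: nat and x :: "nat \<Rightarrow> 'a"
    assume "\<And>m. m < n \<Longrightarrow> x m \<in> A \<and> (\<forall>k<m. R (x k) (x m))"
    then have "x ` {..<n} \<subseteq> A" by blast
    from assms[OF _ this] show "\<exists>r. r \<in> A \<and> (\<forall>m<n. R (x m) r)" by auto
  qed simp
  then show thesis using that by blast
qed

lemma compact_ops_if_totally_bounded:
  fixes T :: "'a::real_normed_vector \<Rightarrow>\<^sub>L 'b::banach"
  assumes "\<And>e. e > 0 \<Longrightarrow> \<exists>F. finite F \<and> (\<forall>x\<in>cball 0 1. \<exists>y\<in>F. norm (blinfun_apply T (x - y)) < e)"
  shows "T \<in> compact_ops"
proof -
  have "\<exists>k. finite k \<and> closure (blinfun_apply T ` cball 0 1) \<subseteq> (\<Union>x\<in>k. ball x e)" if e: "e > 0" for e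
  proof -
    obtain F where F: "finite F" "\<forall>x\<in>cball 0 1. \<exists>y\<in>F. norm (blinfun_apply T (x - y)) < e / 2"
      using assms[of "e / 2"] e by auto
    \<comment> \<open>Closed balls of radius \<open>e / 2\<close> have a closed finite union, so it
      also contains the closure; enlarging them then gives open balls of radius
      \<open>e\<close>.\<close>
    have "blinfun_apply T ` cball 0 1 \<subseteq> (\<Union>z\<in>blinfun_apply T ` F. cball z (e / 2))"
      using F(2) by (fastforce simp: dist_norm norm_minus_commute blinfun.diff_right intro: less_imp_le)
    then have "closure (blinfun_apply T ` cball 0 1) \<subseteq> (\<Union>z\<in>blinfun_apply T ` F. cball z (e / 2))"
      using F(1) by (intro closure_minimal closed_UN) auto
    also have "\<dots> \<subseteq> (\<Union>z\<in>blinfun_apply T ` F. ball z e)"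
      using e by (intro UN_mono) auto
    finally show ?thesis using F(1) by blast
  qed
  then show ?thesis
    by (auto simp: compact_ops_def compact_eq_totally_bounded complete_eq_closed)
qed

text \<open>Here the hypotheses on \<open>S\<close> and \<open>N\<close> meet. One finite net serves
  all \<open>T\<close> in \<open>N\<close>, which yields both compactness of each composition and
  total boundedness for the supremum seminorm.\<close>

lemma weakly_p_precompact_op_net:
  fixes S :: "'x::real_normed_vector \<Rightarrow>\<^sub>L 'z::real_normed_vector"
    and N :: "('z \<Rightarrow>\<^sub>L 'y::real_normed_vector) set"
  assumes S: "weakly_p_precompact_op p S" and N: "uniformly_p_convergent p N" and e: "e > 0"
  shows "\<exists>F. finite F \<and> (\<forall>x\<in>cball 0 1. \<exists>y\<in>F. \<forall>T\<in>N. norm (blinfun_apply T (blinfun_apply S (x - y))) < e)"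
proof (rule ccontr)
  assume no_net: "\<not> ?thesis"
  define R where "R y x \<longleftrightarrow> (\<exists>T\<in>N. \<not> norm (blinfun_apply T (blinfun_apply S (x - y))) < e)" for y x
  have "\<not> (\<exists>F. finite F \<and> (\<forall>x\<in>cball 0 1. \<exists>y\<in>F. \<not> R y x))"
    using no_net by (simp add: R_def)
  then have "\<exists>x\<in>cball 0 1. \<forall>y\<in>F. R y x" if "finite F" for F
    using that by blast
  then obtain x :: "nat \<Rightarrow> 'x" where x: "\<And>n. x n \<in> cball 0 1" "\<And>m n. m < n \<Longrightarrow> R (x m) (x n)"
    using separated_sequence[of "cball 0 1" R] by metis
  have "\<forall>n. blinfun_apply S (x n) \<in> blinfun_apply S ` cball 0 1"
    using x(1) by blast
  then obtain r where r: "strict_mono r" "weakly_p_Cauchy p ((\<lambda>n. blinfun_apply S (x n)) \<circ> r)"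
    using S[unfolded weakly_p_precompact_op_def weakly_p_precompact_def, rule_format,
        of "\<lambda>n. blinfun_apply S (x n)"] by blast
  \<comment> \<open>The index sequences \<open>Suc\<close> and the identity produce consecutive
    differences; uniform p-convergence makes these small on all of \<open>N\<close>, against the
    separation.\<close>
  have "weakly_p_summable p (\<lambda>k. blinfun_apply S (x (r (Suc k))) - blinfun_apply S (x (r k)))"
    using r(2)[unfolded weakly_p_Cauchy_def, rule_format, of Suc "\<lambda>k. k"]
    by (simp add: strict_mono_def)
  from uniformly_p_convergent_eventually[OF N this e]
  obtain k where "\<forall>T\<in>N. norm (blinfun_apply T (blinfun_apply S (x (r (Suc k)) - x (r k)))) < e"
    by (auto simp: eventually_sequentially blinfun.diff_right)
  then show False
    using x(2)[of "r k" "r (Suc k)"] r(1) by (auto simp: R_def strict_mono_def)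
qed

theorem proposition3p3:
  fixes p :: real
    and S :: "'x::banach \<Rightarrow>\<^sub>L 'z::banach"
    and N :: "('z \<Rightarrow>\<^sub>L 'y::banach) set"
  assumes "1 \<le> p"
    and "weakly_p_precompact_op p S"
    and "N \<subseteq> p_convergent_ops p"
    and "uniformly_p_convergent p N"
  shows "equicompact {T o\<^sub>L S |T. T \<in> N}"
\<comment> \<open>The supremum defining \<open>q\<close> is a real one, so the empty family is
  settled separately, with the zero sequence.\<close>
proof (cases "N = {}")
  case True
  then show ?thesis
    unfolding equicompact_def by (intro conjI exI[of _ "\<lambda>_. 0"]) auto
next
  case False
  note net = weakly_p_precompact_op_net[OF assms(2,4)]
  have "T o\<^sub>L S \<in> compact_ops" if "T \<in> N" for T
    by (rule compact_ops_if_totally_bounded) (use net that in \<open>simp, meson\<close>)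
  define q where "q x = (SUP T\<in>N. norm (blinfun_apply T (blinfun_apply S x)))" for x
  have "bdd_above ((\<lambda>T. norm (blinfun_apply T (blinfun_apply S x))) ` N)" for x
    using uniformly_p_convergent_pointwise_bounded[OF assms(1,4), of "blinfun_apply S x"]
    by (auto simp: bdd_above_def)
  then have upper: "norm (blinfun_apply T (blinfun_apply S x)) \<le> q x" if "T \<in> N" for T x
    unfolding q_def using that by (intro cSUP_upper)
  have least: "q x \<le> c" if "\<And>T. T \<in> N \<Longrightarrow> norm (blinfun_apply T (blinfun_apply S x)) \<le> c" for x c
    unfolding q_def using that False by (intro cSUP_least)
  have q_add: "q (x + y) \<le> q x + q y" for x y
    by (intro least)
      (auto simp: blinfun.add_right intro!: order_trans[OF norm_triangle_ineq] add_mono upper)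
  have q_scale_le: "q (c *\<^sub>R x) \<le> \<bar>c\<bar> * q x" for c x
    by (intro least) (auto simp: blinfun.scaleR_right intro!: mult_left_mono upper)
  have q_scale: "q (c *\<^sub>R x) = \<bar>c\<bar> * q x" for c x
  proof (rule antisym[OF q_scale_le])
    obtain T where "T \<in> N" using False by blast
    then have "0 \<le> q (c *\<^sub>R x)" using upper[of T "c *\<^sub>R x"] norm_ge_zero order_trans by blast
    then show "\<bar>c\<bar> * q x \<le> q (c *\<^sub>R x)"
      \<comment> \<open>For nonzero \<open>c\<close> the reverse inequality is
        \<open>q_scale_le\<close> for the inverse scalar; for \<open>c = 0\<close> it is
        nonnegativity of \<open>q\<close>.\<close>
      using q_scale_le[of "inverse c" "c *\<^sub>R x"] by (cases "c = 0") (auto simp: field_simps)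
  qed
  have q_net: "\<exists>F. finite F \<and> (\<forall>x\<in>cball 0 1. \<exists>y\<in>F. q (x - y) < e)" if "e > 0" for e
  proof -
    \<comment> \<open>Strict bounds for each \<open>T\<close> give only a weak bound for the
      supremum, hence \<open>e / 2\<close>.\<close>
    obtain F where F: "finite F"
      "\<forall>x\<in>cball 0 1. \<exists>y\<in>F. \<forall>T\<in>N. norm (blinfun_apply T (blinfun_apply S (x - y))) < e / 2"
      using net[of "e / 2"] \<open>e > 0\<close> by auto
    have "\<exists>y\<in>F. q (x - y) < e" if x: "x \<in> cball 0 1" for x
    proof -
      obtain y where "y \<in> F"
        "\<And>T. T \<in> N \<Longrightarrow> norm (blinfun_apply T (blinfun_apply S (x - y))) < e / 2"
        using F(2) x by blast
      then have "q (x - y) \<le> e / 2" by (intro least less_imp_le)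
      then show ?thesis using \<open>y \<in> F\<close> \<open>e > 0\<close> by (intro bexI[of _ y]) auto
    qed
    then show ?thesis using F(1) by blast
  qed
  obtain \<phi> :: "nat \<Rightarrow> 'x \<Rightarrow>\<^sub>L real"
    where \<phi>: "\<phi> \<longlonglongrightarrow> 0" "\<And>x. q x \<le> (SUP n. \<bar>blinfun_apply (\<phi> n) x\<bar>)"
    using seminorm_le_SUP_null_sequence[of q, OF q_add q_scale q_net] by blast
  have "norm (blinfun_apply (T o\<^sub>L S) x) \<le> (SUP n. \<bar>blinfun_apply (\<phi> n) x\<bar>)" if "T \<in> N" for T x
    using order_trans[OF upper[OF that] \<phi>(2)] by simp
  moreover have "(\<lambda>n. norm (\<phi> n)) \<longlonglongrightarrow> 0"
    using \<phi>(1) by (rule tendsto_norm_zero)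
  ultimately show ?thesis
    using \<open>\<And>T. T \<in> N \<Longrightarrow> T o\<^sub>L S \<in> compact_ops\<close> unfolding equicompact_def by blast
qed

end
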